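(* Let $n\ge2$, let $\mathcal{S}(n)$ be the space of real symmetric $n\times n$ matrices, and let $P$ be an $I_n$-central hyperbolic polynomial of degree $m$ on $\mathcal{S}(n)$ with Gårding cone $\Gamma(P)_+$. If $\Gamma(P)_+ \supset \Gamma(\sigma_2)_+$, then \[P(A)^{\frac{1}{m}} \geq P(I_n)^{\frac{1}{m}} \left(\frac{\sigma_2(A)}{\binom{n}{2}}\right)^{\frac{1}{2}} \quad \text{for every } A \in \Gamma(\sigma_2)_+.\]
   Context: $I_n$ is the identity matrix. For $A\in\mathcal{S}(n)$ with eigenvalues $\lambda_1(A),\dots,\lambda_n(A)$, $\sigma_2(A)=\sum_{i<j}\lambda_i(A)\lambda_j(A)$. A homogeneous polynomial $p$ of degree $m$ (with $m \ge 1$) on a finite-dimensional real vector space $V$ is hyperbolic with respect to $a\in V$ ($a$-hyperbolic) if $p(a)>0$ and for every $x\in V$ the polynomial $s\mapsto p(sa+x)$ has only real roots; then $p(sa+x)=p(a)\prod_{j=1}^m(s+\lambda_j^{p,a}(x))$ with real $\lambda_j^{p,a}(x)$. Its Gårding cone is $\Gamma(p)_+=\{x:\lambda^{p,a}_j(x)>0\ \forall j\}$, equivalently the connected component of $\{p>0\}$ containing $a$; by Gårding's theorem $p$ is $b$-hyperbolic with the same Gårding cone for every $b\in\Gamma(p)_+$. Set $\operatorname{tr}^{p,a}(x)=\sum_{j=1}^m\lambda_j^{p,a}(x)$. An $I_n$-hyperbolic polynomial $P$ of degree $m$ on $\mathcal{S}(n)$ is $I_n$-central if there is a constant $\kappa>0$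 with $\operatorname{tr}^{P,I_n}(X)=\kappa\operatorname{tr}(X)$ for all $X\in\mathcal{S}(n)$ (necessarily $\kappa=m/n$). The polynomial $\sigma_2$ on $\mathcal{S}(n)$ is $I_n$-hyperbolic; $\Gamma(\sigma_2)_+$ denotes its Gårding cone (with respect to $I_n$), which equals $\{X:\operatorname{tr}(X)>0,\ \sigma_2(X)>0\}$. *)

theory Defs
  imports "HOL-Analysis.Analysis" "HOL-Computational_Algebra.Fundamental_Theorem_Algebra"
begin

section \<open>Hyperbolic polynomials\<close>

text \<open>
  The vector space is a subspace \<open>V\<close> of an ambient normed space; a polynomial on \<open>V\<close> is the
  restriction to \<open>V\<close> of a polynomial function on the ambient space.  Nothing is required of the
  values of \<open>p\<close> outside \<open>V\<close>.  All monomials of a polynomial function have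
  degree \<open>m\<close> iff it scales as below.
\<close>

definition homogeneous_polynomial_on ::
    "'a::real_normed_vector set \<Rightarrow> nat \<Rightarrow> ('a \<Rightarrow> real) \<Rightarrow> bool" where
  "homogeneous_polynomial_on V m p \<longleftrightarrow>
     (\<exists>q. real_polynomial_function q \<and> (\<forall>x\<in>V. p x = q x)) \<and>
     (\<forall>x\<in>V. \<forall>t. p (t *\<^sub>R x) = t ^ m * p x)"

text \<open>
  The univariate polynomial \<open>q\<close> below is determined by its values on the reals; it is nonzero,
  because \<open>p a > 0\<close>.  ``Only real roots'' refers to its complex roots.
\<close>

definition hyperbolic_on ::
    "'a::real_normed_vector set \<Rightarrow> nat \<Rightarrow> 'a \<Rightarrow> ('a \<Rightarrow> real) \<Rightarrow> bool" where
  "hyperbolic_on V m a p \<longleftrightarrow>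
     m \<ge> 1 \<and> a \<in> V \<and> homogeneous_polynomial_on V m p \<and> p a > 0 \<and>
     (\<forall>x\<in>V. \<exists>q :: real poly.
        (\<forall>s. poly q s = p (s *\<^sub>R a + x)) \<and>
        (\<forall>z. poly (map_poly complex_of_real q) z = 0 \<longrightarrow> z \<in> \<real>))"

text \<open>
  The numbers \<open>\<lambda>\<^sub>j\<close> with \<open>p (s a + x) = p a \<Prod>\<^sub>j (s + \<lambda>\<^sub>j)\<close>, as a multiset; see
  \<open>garding_eigenvalues_factorization\<close> and \<open>size_garding_eigenvalues\<close> below.
\<close>

definition garding_eigenvalues ::
    "('a::real_vector \<Rightarrow> real) \<Rightarrow> 'a \<Rightarrow> 'a \<Rightarrow> real multiset" where
  "garding_eigenvalues p a x =
     (THE M. \<forall>s. p (s *\<^sub>R a + x) = p a * (\<Prod>l\<in>#M. s + l))"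

definition garding_cone ::
    "'a::real_vector set \<Rightarrow> 'a \<Rightarrow> ('a \<Rightarrow> real) \<Rightarrow> 'a set" where
  "garding_cone V a p = {x \<in> V. \<forall>l \<in># garding_eigenvalues p a x. l > 0}"

definition garding_trace ::
    "('a::real_vector \<Rightarrow> real) \<Rightarrow> 'a \<Rightarrow> 'a \<Rightarrow> real" where
  "garding_trace p a x = (\<Sum>l\<in>#garding_eigenvalues p a x. l)"

lemma real_linear_factors_unique:
  fixes M N :: "real multiset"
  assumes "\<And>s. (\<Prod>l\<in>#M. s + l) = (\<Prod>l\<in>#N. s + l)"
  shows "M = N"
proof -
  have pr: "proots (\<Prod>l\<in>#K. [:l, 1:]) = image_mset uminus K" for K :: "real multiset"
  proof (induction K)
    case (add l K)
    have "(\<Prod>l\<in>#K. [:l, 1:]) \<noteq> 0"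
      by (auto simp: prod_mset_zero_iff)
    then show ?case
      using add by (simp add: proots_mult del: mult_pCons_left)
  qed simp
  have pv: "poly (\<Prod>l\<in>#K. [:l, 1:]) s = (\<Prod>l\<in>#K. s + l)" for K :: "real multiset" and s
    by (induction K) (auto simp: algebra_simps)
  have "(\<Prod>l\<in>#M. [:l, 1:]) = (\<Prod>l\<in>#N. [:l, 1:])"
    by (rule poly_ext) (simp add: pv assms)
  then have "image_mset uminus (image_mset uminus M) = image_mset uminus (image_mset uminus N)"
    by (metis pr)
  then show ?thesis
    by (simp add: multiset.map_comp o_def)
qed

lemma garding_eigenvalues_eqI:
  assumes "p a \<noteq> 0" and "\<And>s. p (s *\<^sub>R a + x) = p a * (\<Prod>l\<in>#M. s + l)"
  shows "garding_eigenvalues p a x = M"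
  unfolding garding_eigenvalues_def
proof (rule the_equality)
  fix N assume N: "\<forall>s. p (s *\<^sub>R a + x) = p a * (\<Prod>l\<in>#N. s + l)"
  show "N = M"
    by (rule real_linear_factors_unique) (use N assms in simp)
qed (use assms in simp)

lemma real_rooted_factorization:
  fixes q :: "real poly"
  assumes "\<And>z. poly (map_poly complex_of_real q) z = 0 \<Longrightarrow> z \<in> \<real>"
  obtains M where "\<And>s. poly q s = lead_coeff q * (\<Prod>l\<in>#M. s + l)"
proof
  fix s :: real
  let ?c = "map_poly complex_of_real q"
  let ?M = "image_mset (\<lambda>z. - Re z) (proots ?c)"
  show "poly q s = lead_coeff q * (\<Prod>l\<in>#?M. s + l)"
  proof (cases "q = 0")
    case False
    then have c0: "?c \<noteq> 0"
      by (simp add: map_poly_eq_0_iff)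
    have re: "complex_of_real (Re z) = z" if "z \<in># proots ?c" for z
      using that c0 assms by (auto elim!: Reals_cases)
    have "complex_of_real (poly q s) = poly ?c (complex_of_real s)"
      by (induction q) (simp_all add: map_poly_pCons)
    also have "\<dots> = poly (smult (lead_coeff ?c) (\<Prod>z\<in>#proots ?c. [:- z, 1:])) (complex_of_real s)"
      by (subst complex_poly_decompose_multiset) simp
    also have "\<dots> = lead_coeff ?c * (\<Prod>z\<in>#proots ?c. complex_of_real s - z)"
      by (simp add: poly_prod_mset multiset.map_comp o_def)
    also have "(\<Prod>z\<in>#proots ?c. complex_of_real s - z)
               = (\<Prod>z\<in>#proots ?c. complex_of_real (s + - Re z))"
      by (intro arg_cong[where f = prod_mset] image_mset_cong) (use re in simp)
    also have "\<dots> = complex_of_real (\<Prod>l\<in>#?M. s + l)"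
    proof -
      have "(\<Prod>z\<in>#K. complex_of_real (s + - Re z))
            = complex_of_real (\<Prod>l\<in>#image_mset (\<lambda>z. - Re z) K. s + l)" for K
        by (induction K) auto
      then show ?thesis .
    qed
    also have "lead_coeff ?c = complex_of_real (lead_coeff q)"
      by (simp add: coeff_map_poly degree_map_poly)
    finally have "complex_of_real (poly q s)
        = complex_of_real (lead_coeff q * (\<Prod>l\<in>#?M. s + l))"
      by simp
    then show ?thesis
      using of_real_eq_iff by blast
  qed simp
qed

lemma hyperbolic_on_factorization:
  assumes V: "subspace V" and hyp: "hyperbolic_on V m a p" and x: "x \<in> V"
  obtains M where "size M = m" and "\<And>s. p (s *\<^sub>R a + x) = p a * (\<Prod>l\<in>#M. s + l)"
proof -
  have a: "a \<in> V" and pa: "p a > 0" and hom: "\<And>t x. x \<in> V \<Longrightarrow> p (t *\<^sub>R x) = t ^ m * p x"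
    using hyp by (auto simp: hyperbolic_on_def homogeneous_polynomial_on_def)
  obtain g where g: "real_polynomial_function g" "\<And>x. x \<in> V \<Longrightarrow> p x = g x"
    using hyp by (auto simp: hyperbolic_on_def homogeneous_polynomial_on_def)
  obtain q where q: "\<And>s. poly q s = p (s *\<^sub>R a + x)"
    "\<And>z. poly (map_poly complex_of_real q) z = 0 \<Longrightarrow> z \<in> \<real>"
    using hyp x unfolding hyperbolic_on_def by blast
  obtain M where M: "\<And>s. poly q s = lead_coeff q * (\<Prod>l\<in>#M. s + l)"
    using real_rooted_factorization[OF q(2)] by blast
  define c k where "c = lead_coeff q" and "k = size M"
  have inV: "s *\<^sub>R a + t *\<^sub>R x \<in> V" for s t
    using V a x by (simp add: subspace_add subspace_scale)
  have scale: "t ^ k * p (a + t *\<^sub>R x) = t ^ m * (c * (\<Prod>l\<in>#M. 1 + t * l))" if "t \<noteq> 0" for t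
  proof -
    have "p (a + t *\<^sub>R x) = p (t *\<^sub>R (inverse t *\<^sub>R a + x))"
      using that by (simp add: scaleR_add_right)
    also have "\<dots> = t ^ m * (c * (\<Prod>l\<in>#M. inverse t + l))"
      using hom[of "inverse t *\<^sub>R a + x" t] inV[of "inverse t" 1] q(1) M by (simp add: c_def)
    finally have "p (a + t *\<^sub>R x) = t ^ m * (c * (\<Prod>l\<in>#M. inverse t + l))" .
    moreover have "t ^ size K * (\<Prod>l\<in>#K. inverse t + l) = (\<Prod>l\<in>#K. 1 + t * l)" for K
      using that by (induction K) (auto simp: field_simps)
    ultimately show ?thesis
      by (simp add: k_def)
  qed
  have lim1: "((\<lambda>t. p (a + t *\<^sub>R x)) \<longlongrightarrow> p a) (at 0)"
  proof -
    have "isCont g (a + 0 *\<^sub>R x)"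
      using g(1) by (simp add: real_polynomial_function_eq continuous_polymonial_function)
    moreover have "isCont (\<lambda>t. a + t *\<^sub>R x) 0"
      by (intro continuous_intros)
    ultimately have "isCont (\<lambda>t. g (a + t *\<^sub>R x)) 0"
      using continuous_at_compose[of 0 "\<lambda>t. a + t *\<^sub>R x" g] by (simp add: o_def)
    then show ?thesis
      using g(2) inV[of 1] a by (simp add: isCont_def)
  qed
  have lim2: "((\<lambda>t. \<Prod>l\<in>#M. 1 + t * l) \<longlongrightarrow> 1) (at 0)"
  proof -
    have "isCont (\<lambda>t::real. \<Prod>l\<in>#K. 1 + t * l) 0" for K
      by (induction K) (auto intro!: continuous_intros)
    moreover have "(\<Prod>l\<in>#K. 1 + 0 * l) = (1::real)" for K
      by (induction K) auto
    ultimately show ?thesis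
      unfolding isCont_def by metis
  qed
  have ev: "\<forall>\<^sub>F t in at (0::real). t \<noteq> 0"
    by (simp add: eventually_at_filter)
  have pow0: "((\<lambda>t::real. t ^ d) \<longlongrightarrow> 0) (at 0)" if "d > 0" for d
  proof -
    have "isCont (\<lambda>t::real. t ^ d) 0"
      by (intro continuous_intros)
    then show ?thesis
      using that by (simp add: isCont_def)
  qed
  consider "k < m" | "m < k" | "k = m"
    by linarith
  then have "k = m \<and> c = p a"
  proof cases
    case 1
    have "p (a + t *\<^sub>R x) = t ^ (m - k) * (c * (\<Prod>l\<in>#M. 1 + t * l))" if "t \<noteq> 0" for t
    proof -
      have "t ^ m = t ^ k * t ^ (m - k)"
        using 1 by (simp flip: power_add)
      then show ?thesis
        using scale[OF that] that by simp
    qed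
    then have eq: "\<forall>\<^sub>F t in at 0. t ^ (m - k) * (c * (\<Prod>l\<in>#M. 1 + t * l)) = p (a + t *\<^sub>R x)"
      by (intro eventually_mono[OF ev]) simp
    have "((\<lambda>t. t ^ (m - k) * (c * (\<Prod>l\<in>#M. 1 + t * l))) \<longlongrightarrow> 0 * (c * 1)) (at 0)"
      using 1 by (intro tendsto_mult pow0 tendsto_const lim2) simp
    then have "((\<lambda>t. p (a + t *\<^sub>R x)) \<longlongrightarrow> 0 * (c * 1)) (at 0)"
      using eq by (rule Lim_transform_eventually)
    then show ?thesis
      using lim1 pa tendsto_unique[of "at (0::real)"] by force
  next
    case 2
    have eq: "t ^ (k - m) * p (a + t *\<^sub>R x) = c * (\<Prod>l\<in>#M. 1 + t * l)" if "t \<noteq> 0" for t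
    proof -
      have "t ^ k = t ^ m * t ^ (k - m)"
        using 2 by (simp flip: power_add)
      then show ?thesis
        using scale[OF that] that by simp
    qed
    have "((\<lambda>t. t ^ (k - m) * p (a + t *\<^sub>R x)) \<longlongrightarrow> 0 * p a) (at 0)"
      using 2 by (intro tendsto_mult pow0 lim1) simp
    then have "((\<lambda>t. c * (\<Prod>l\<in>#M. 1 + t * l)) \<longlongrightarrow> 0 * p a) (at 0)"
      by (rule Lim_transform_eventually) (intro eventually_mono[OF ev], simp add: eq)
    moreover have "((\<lambda>t. c * (\<Prod>l\<in>#M. 1 + t * l)) \<longlongrightarrow> c * 1) (at 0)"
      by (intro tendsto_intros lim2)
    ultimately have "c = 0"
      using tendsto_unique[of "at (0::real)"] by force
    then have "p (a + t *\<^sub>R x) = 0" if "t \<noteq> 0" for t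
      using eq[OF that] that by simp
    then have "((\<lambda>t. p (a + t *\<^sub>R x)) \<longlongrightarrow> 0) (at 0)"
      by (intro Lim_transform_eventually[OF tendsto_const] eventually_mono[OF ev]) auto
    then show ?thesis
      using lim1 pa tendsto_unique[of "at (0::real)"] by force
  next
    case 3
    have "p (a + t *\<^sub>R x) = c * (\<Prod>l\<in>#M. 1 + t * l)" if "t \<noteq> 0" for t
      using scale[OF that] that 3 by simp
    then have "((\<lambda>t. p (a + t *\<^sub>R x)) \<longlongrightarrow> c * 1) (at 0)"
      by (intro Lim_transform_eventually[OF tendsto_mult[OF tendsto_const lim2]]
          eventually_mono[OF ev]) auto
    then show ?thesis
      using 3 lim1 tendsto_unique[of "at (0::real)"] by force
  qed
  then show ?thesis
    using that[of M] M q(1) by (simp add: k_def c_def)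
qed

lemma garding_eigenvalues_factorization:
  assumes "subspace V" "hyperbolic_on V m a p" "x \<in> V"
  shows "p (s *\<^sub>R a + x) = p a * (\<Prod>l\<in>#garding_eigenvalues p a x. s + l)"
    and size_garding_eigenvalues: "size (garding_eigenvalues p a x) = m"
proof -
  obtain M where M: "size M = m" "\<And>s. p (s *\<^sub>R a + x) = p a * (\<Prod>l\<in>#M. s + l)"
    using hyperbolic_on_factorization[OF assms] by blast
  moreover have "p a \<noteq> 0"
    using assms(2) by (simp add: hyperbolic_on_def)
  ultimately have "garding_eigenvalues p a x = M"
    by (intro garding_eigenvalues_eqI)
  with M show "p (s *\<^sub>R a + x) = p a * (\<Prod>l\<in>#garding_eigenvalues p a x. s + l)"
    and "size (garding_eigenvalues p a x) = m"
    by auto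
qed


section \<open>Symmetric matrices\<close>

definition symmetric_matrices :: "(real ^ 'n ^ 'n) set" where
  "symmetric_matrices = {A. transpose A = A}"

lemma subspace_symmetric_matrices: "subspace symmetric_matrices"
  by (auto simp: subspace_def symmetric_matrices_def transpose_def vec_eq_iff)

definition char_polynomial :: "real ^ 'n ^ 'n \<Rightarrow> real poly" where
  "char_polynomial A = det (mat [:0, 1:] - map_matrix (\<lambda>c. [:c:]) A)"

text \<open>
  The eigenvalues of a symmetric \<open>A\<close> with multiplicity, \<open>eigenvalue A 0 \<le> \<dots> \<le> eigenvalue A (n - 1)\<close>.
  For such \<open>A\<close> the characteristic polynomial has \<open>n\<close> real roots; for other
  matrices the value is unspecified and plays no role.
\<close>

definition eigenvalue :: "real ^ 'n ^ 'n \<Rightarrow> nat \<Rightarrow> real" where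
  "eigenvalue A i = sorted_list_of_multiset (proots (char_polynomial A)) ! i"

definition sigma2 :: "real ^ 'n ^ 'n \<Rightarrow> real" where
  "sigma2 A = (\<Sum>j<CARD('n). \<Sum>i<j. eigenvalue A i * eigenvalue A j)"

definition central_hyperbolic :: "nat \<Rightarrow> (real ^ 'n ^ 'n \<Rightarrow> real) \<Rightarrow> bool" where
  "central_hyperbolic m P \<longleftrightarrow>
     hyperbolic_on symmetric_matrices m (mat 1) P \<and>
     (\<exists>\<kappa>>0. \<forall>X\<in>symmetric_matrices. garding_trace P (mat 1) X = \<kappa> * trace X)"

end

theory Submission
  imports Defs
begin

text \<open>
  Everything happens on the plane spanned by \<open>I\<close> and \<open>A\<close>.  There \<open>\<sigma>\<^sub>2\<close> has two eigenvalues
  \<open>t - r \<le> t + r\<close> with \<open>t = tr A / n\<close>, and \<open>P\<close> has eigenvalues \<open>\<lambda>\<^sub>1, \<dots>, \<lambda>\<^sub>m\<close> whose mean is also \<open>t\<close>,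
  because \<open>P\<close> is central.  Testing the inclusion of the cones on \<open>c I + A\<close> and \<open>c I - A\<close> places
  every \<open>\<lambda>\<^sub>j\<close> in \<open>[t - r, t + r]\<close>.  As \<open>ln\<close> is concave it lies above its chord over this interval,
  and summing over \<open>j\<close> gives \<open>\<Prod>\<^sub>j \<lambda>\<^sub>j \<ge> ((t - r) (t + r))\<^bsup>m/2\<^esup>\<close>, which is the claim.
\<close>

section \<open>Diagonalisation of real symmetric matrices\<close>

text \<open>Near \<open>t = 0\<close> the linear term dominates, so a nonzero \<open>b\<close> would
  make the expression negative for a small \<open>t\<close> of sign opposite to \<open>b\<close>.
  This is the first-order condition at a maximum.\<close>

lemma linear_coefficient_eq_0:
  fixes b k :: real
  assumes "\<And>t. 0 \<le> 2 * t * b + t\<^sup>2 * k"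
  shows "b = 0"
proof (rule ccontr)
  assume "b \<noteq> 0"
  define K where "K = \<bar>k\<bar> + 1"
  have K: "K > 0" "k \<le> K"
    by (auto simp: K_def)
  have "0 \<le> 2 * (- b / K) * b + (- b / K)\<^sup>2 * k"
    by (rule assms)
  also have "\<dots> \<le> 2 * (- b / K) * b + (- b / K)\<^sup>2 * K"
    using K by (intro add_left_mono mult_left_mono) auto
  also have "\<dots> = - (b\<^sup>2 / K)"
    using K by (simp add: field_simps power2_eq_square)
  also have "\<dots> < 0"
    using K \<open>b \<noteq> 0\<close> by simp
  finally show False
    by simp
qed

text \<open>Maximise the Rayleigh quotient over the unit sphere of \<open>S\<close>, which is
  compact. A maximiser is stationary in all directions of \<open>S\<close>, and this is the
  eigenvector equation.\<close>

lemma self_adjoint_eigenvector: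
  fixes f :: "'a::euclidean_space \<Rightarrow> 'a"
  assumes f: "linear f" and sym: "\<And>x y. f x \<bullet> y = x \<bullet> f y"
    and S: "subspace S" and inv: "f ` S \<subseteq> S" and nz: "S \<noteq> {0}"
  obtains v c where "v \<in> S" "norm v = 1" "f v = c *\<^sub>R v"
proof -
  let ?K = "S \<inter> sphere 0 1"
  have "compact ?K"
    using S by (intro closed_Int_compact closed_subspace) auto
  moreover have "?K \<noteq> {}"
  proof -
    obtain x where "x \<in> S" "x \<noteq> 0"
      using nz subspace_0[OF S] by auto
    then have "x /\<^sub>R norm x \<in> ?K"
      using S by (auto simp: subspace_scale)
    then show ?thesis by blast
  qed
  moreover have "continuous_on ?K (\<lambda>x. f x \<bullet> x)"
    using f by (intro continuous_intros linear_continuous_on linear_conv_bounded_linear[THEN iffD1])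
  ultimately obtain v where v: "v \<in> ?K" and max: "\<And>x. x \<in> ?K \<Longrightarrow> f x \<bullet> x \<le> f v \<bullet> v"
    using continuous_attains_sup[of ?K "\<lambda>x. f x \<bullet> x"] by blast
  define c where "c = f v \<bullet> v"
  have vS: "v \<in> S" and nv: "norm v = 1"
    using v by auto
  then have vv: "v \<bullet> v = 1"
    by (simp add: norm_eq_1)
  have le: "f x \<bullet> x \<le> c * (x \<bullet> x)" if "x \<in> S" for x
  proof (cases "x = 0")
    case False
    have "x /\<^sub>R norm x \<in> ?K"
      using S that False by (auto simp: subspace_scale)
    then have "f (x /\<^sub>R norm x) \<bullet> (x /\<^sub>R norm x) \<le> c"
      unfolding c_def by (rule max)
    then have "(f x \<bullet> x) / (norm x)\<^sup>2 \<le> c"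
      by (simp add: linear_cmul[OF f] power2_eq_square divide_inverse mult_ac)
    then show ?thesis
      using False by (simp add: divide_le_eq dot_square_norm)
  qed (simp add: linear_0[OF f])
  \<comment> \<open>Apply \<open>le\<close> to \<open>v + t *\<^sub>R y\<close>: the constant term
    of the quadratic in \<open>t\<close> vanishes because \<open>v\<close> attains the
    maximum.\<close>
  have stationary: "c * (v \<bullet> y) - f v \<bullet> y = 0" if y: "y \<in> S" for y
  proof (rule linear_coefficient_eq_0)
    fix t :: real
    have "v + t *\<^sub>R y \<in> S"
      using S vS y by (simp add: subspace_add subspace_scale)
    from le[OF this] have "0 \<le> c * ((v + t *\<^sub>R y) \<bullet> (v + t *\<^sub>R y)) - f (v + t *\<^sub>R y) \<bullet> (v + t *\<^sub>R y)"
      by simp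
    also have "\<dots> = 2 * t * (c * (v \<bullet> y) - f v \<bullet> y) + t\<^sup>2 * (c * (y \<bullet> y) - f y \<bullet> y)"
      using vv sym[of y v]
      by (simp add: linear_add[OF f] linear_cmul[OF f] inner_add_left inner_add_right
          algebra_simps power2_eq_square inner_commute c_def)
    finally show "0 \<le> 2 * t * (c * (v \<bullet> y) - f v \<bullet> y) + t\<^sup>2 * (c * (y \<bullet> y) - f y \<bullet> y)" .
  qed
  \<comment> \<open>Invariance of \<open>S\<close> makes the residual itself an admissible
    direction.\<close>
  have "c *\<^sub>R v - f v \<in> S"
    using S vS inv by (auto simp: subspace_diff subspace_scale)
  from stationary[OF this] have "(c *\<^sub>R v - f v) \<bullet> (c *\<^sub>R v - f v) = 0"
    by (simp add: inner_diff_left)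
  then show ?thesis
    using that[OF vS nv, of c] by simp
qed

text \<open>Induction on the dimension: split off a unit eigenvector \<open>v\<close>.
  Self-adjointness keeps the orthogonal complement of \<open>v\<close> in \<open>S\<close>
  invariant, and its dimension is one less.\<close>

lemma self_adjoint_orthonormal_eigenbasis:
  fixes f :: "'a::euclidean_space \<Rightarrow> 'a"
  assumes f: "linear f" and sym: "\<And>x y. f x \<bullet> y = x \<bullet> f y"
    and "subspace S" and "f ` S \<subseteq> S"
  shows "\<exists>B\<subseteq>S. card B = dim S \<and> finite B \<and> pairwise orthogonal B \<and>
    (\<forall>v\<in>B. norm v = 1 \<and> (\<exists>c. f v = c *\<^sub>R v))"
  using assms(3,4)
proof (induction "dim S" arbitrary: S)
  case 0
  then show ?case
    by (intro exI[of _ "{}"]) auto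
next
  case (Suc k)
  then have "S \<noteq> {0}"
    by (metis dim_singleton nat.distinct(1) dim_eq_0 subset_refl)
  then obtain v c where v: "v \<in> S" "norm v = 1" "f v = c *\<^sub>R v"
    using self_adjoint_eigenvector[OF f sym Suc.prems] by blast
  let ?T = "{y \<in> S. v \<bullet> y = 0}"
  have T: "subspace ?T"
    using Suc.prems(1) by (auto simp: subspace_def inner_add_right)
  have "v \<bullet> f y = c * (v \<bullet> y)" for y
    using sym[of v y] v(3) by simp
  then have "f ` ?T \<subseteq> ?T"
    using Suc.prems(2) by auto
  moreover have "dim ?T = k"
  proof -
    have "span {v} \<subseteq> S"
      using v(1) Suc.prems(1) by (intro span_minimal) auto
    then have "dim {y \<in> S. \<forall>x\<in>span {v}. orthogonal x y} + dim (span {v}) = dim S"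
      using Suc.prems(1) by (intro dim_subspace_orthogonal_to_vectors) auto
    moreover have "{y \<in> S. \<forall>x\<in>span {v}. orthogonal x y} = ?T"
      by (auto simp: orthogonal_def span_singleton)
    moreover have "v \<noteq> 0"
      using v(2) by auto
    ultimately show ?thesis
      using Suc.hyps(2) by (simp add: dim_eq_card_independent)
  qed
  ultimately obtain B where B: "B \<subseteq> ?T" "card B = k" "finite B" "pairwise orthogonal B"
    "\<forall>v\<in>B. norm v = 1 \<and> (\<exists>c. f v = c *\<^sub>R v)"
    using Suc.hyps(1)[OF _ T] by metis
  have "v \<notin> B"
    using B(1) v(2) by (auto simp: norm_eq_1)
  moreover have "pairwise orthogonal (insert v B)"
    using B(1,4) by (auto simp: pairwise_insert orthogonal_def inner_commute)
  ultimately show ?case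
    using B v Suc.hyps(2) by (intro exI[of _ "insert v B"]) auto
qed

section \<open>Orthogonal diagonalisation of matrices and the characteristic polynomial\<close>

definition diagonal_matrix :: "('n \<Rightarrow> real) \<Rightarrow> real ^ 'n ^ 'n" where
  "diagonal_matrix d = (\<chi> i j. if i = j then d i else 0)"

lemma symmetric_matrix_diagonalisation:
  fixes A :: "real ^ 'n ^ 'n"
  assumes "A \<in> symmetric_matrices"
  obtains Q d where "orthogonal_matrix Q" "A = Q ** diagonal_matrix d ** transpose Q"
proof -
  have tA: "transpose A = A"
    using assms by (simp add: symmetric_matrices_def)
  have "(A *v x) \<bullet> y = x \<bullet> (A *v y)" for x y
    by (metis dot_lmul_matrix tA vector_transpose_matrix)
  then obtain B :: "(real ^ 'n) set"
    where B: "card B = CARD('n)" "finite B" "pairwise orthogonal B"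
    "\<forall>v\<in>B. norm v = 1 \<and> (\<exists>c. A *v v = c *\<^sub>R v)"
    using self_adjoint_orthonormal_eigenbasis[of "(*v) A" UNIV] by auto
  obtain e where e: "bij_betw e (UNIV :: 'n set) B"
    using B(1,2) finite_same_card_bij[of "UNIV :: 'n set" B] by auto
  have eB: "e i \<in> B" for i
    using e by (auto simp: bij_betw_def)
  then have "\<forall>i. \<exists>c. A *v e i = c *\<^sub>R e i"
    using B(4) by blast
  then obtain d where d: "\<And>i. A *v e i = d i *\<^sub>R e i"
    using choice[of "\<lambda>i c. A *v e i = c *\<^sub>R e i"] by blast
  have on: "e i \<bullet> e j = (if i = j then 1 else 0)" for i j
  proof (cases "i = j")
    case True
    then show ?thesis using B(4) eB by (simp flip: norm_eq_1)
  next
    case False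
    then have "e i \<noteq> e j"
      using e by (auto simp: bij_betw_def inj_on_def)
    then show ?thesis
      using False B(3) eB by (auto simp: pairwise_def orthogonal_def)
  qed
  \<comment> \<open>The columns are the eigenvectors, so \<open>transpose Q ** Q\<close> is their
    Gram matrix.\<close>
  define Q :: "real ^ 'n ^ 'n" where "Q = (\<chi> i j. e j $ i)"
  have "transpose Q ** Q = mat 1"
    using on by (simp add: Q_def vec_eq_iff matrix_matrix_mult_def transpose_def mat_def inner_vec_def)
  then have Q: "orthogonal_matrix Q"
    by (simp add: orthogonal_matrix)
  have "A ** Q = Q ** diagonal_matrix d"
  proof -
    have "(\<Sum>k\<in>UNIV. A $ i $ k * e j $ k) = d j * e j $ i" for i j
      using arg_cong[OF d[of j], of "\<lambda>v. v $ i"] by (simp add: matrix_vector_mult_def)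
    then show ?thesis
      by (simp add: Q_def diagonal_matrix_def vec_eq_iff matrix_matrix_mult_def if_distrib
          sum.delta mult.commute cong: if_cong)
  qed
  then have "A ** Q ** transpose Q = Q ** diagonal_matrix d ** transpose Q"
    by simp
  then have "A = Q ** diagonal_matrix d ** transpose Q"
    using Q by (simp add: orthogonal_matrix_def flip: matrix_mul_assoc)
  with Q show ?thesis
    by (rule that)
qed

text \<open>Conjugation by \<open>Q\<close> fixes the identity, so one \<open>Q\<close> diagonalises
  the whole plane spanned by \<open>I\<close> and a matrix.\<close>

lemma orthogonal_conjugate_affine:
  fixes D :: "real ^ 'n ^ 'n"
  assumes "orthogonal_matrix Q"
  shows "x *\<^sub>R mat 1 + y *\<^sub>R (Q ** D ** transpose Q)
    = Q ** (x *\<^sub>R mat 1 + y *\<^sub>R D) ** transpose Q"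
proof -
  have "(B + C) ** R = B ** R + C ** R" for B C R :: "real ^ 'n ^ 'n"
    by (simp add: matrix_matrix_mult_def vec_eq_iff sum.distrib distrib_right)
  then show ?thesis
    using assms
    by (simp add: orthogonal_matrix_def matrix_add_ldistrib matrix_scalar_ac
        flip: scalar_matrix_assoc)
qed

lemma diagonal_matrix_affine:
  "x *\<^sub>R mat 1 + y *\<^sub>R diagonal_matrix d = diagonal_matrix (\<lambda>i. x + y * d i)"
  by (simp add: diagonal_matrix_def vec_eq_iff mat_def)

text \<open>Evaluation at \<open>x\<close> is a ring homomorphism and passes through the Leibniz
  expansion; the permutation signs enter as integer constants.\<close>

lemma poly_char_polynomial: "poly (char_polynomial A) x = det (x *\<^sub>R mat 1 - A)"
proof -
  have sign: "poly (of_int k) x = of_int k" for k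
    by (simp flip: of_int_poly)
  show ?thesis
    unfolding char_polynomial_def det_def
    by (simp add: poly_sum poly_prod sign map_matrix_def mat_def if_distrib[of "\<lambda>p. poly p x"]
        if_distrib[of "\<lambda>y. x * y"] cong: if_cong)
qed

text \<open>Links \<open>eigenvalue\<close>, defined through roots, to the explicit diagonal
  \<open>d\<close>: conjugation leaves the determinant of \<open>x I - A\<close> unchanged.\<close>

lemma proots_char_polynomial:
  assumes Q: "orthogonal_matrix Q"
  shows "proots (char_polynomial (Q ** diagonal_matrix d ** transpose Q))
    = image_mset d (mset_set UNIV)"
proof -
  have "poly (char_polynomial (Q ** diagonal_matrix d ** transpose Q)) x
      = poly (\<Prod>i\<in>UNIV. [:- d i, 1:]) x" for x
  proof -
    have "x *\<^sub>R mat 1 - Q ** diagonal_matrix d ** transpose Q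
        = Q ** diagonal_matrix (\<lambda>i. x - d i) ** transpose Q"
      using orthogonal_conjugate_affine[OF Q, of x "-1" "diagonal_matrix d"]
      by (simp add: diagonal_matrix_affine[of x "-1", simplified])
    moreover have "det Q * det (transpose Q) = 1"
      using Q by (metis det_I det_mul orthogonal_matrix_def)
    moreover have "det (diagonal_matrix (\<lambda>i. x - d i)) = (\<Prod>i\<in>UNIV. x - d i)"
      by (subst det_diagonal) (auto simp: diagonal_matrix_def)
    ultimately show ?thesis
      by (simp add: poly_char_polynomial det_mul poly_prod mult_ac)
  qed
  then have "char_polynomial (Q ** diagonal_matrix d ** transpose Q) = (\<Prod>i\<in>UNIV. [:- d i, 1:])"
    by (rule poly_ext)
  moreover have "proots (\<Prod>i\<in>UNIV. [:- d i, 1:]) = (\<Sum>i\<in>UNIV. {#d i#})"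
    by (subst proots_prod) auto
  moreover have "(\<Sum>i\<in>I. {#d i#}) = image_mset d (mset_set I)" if "finite I" for I
    using that by (induction I) auto
  ultimately show ?thesis
    by simp
qed

section \<open>The polynomial \<open>\<sigma>\<^sub>2\<close>\<close>

text \<open>Newton's identity for the second elementary symmetric function. Appending at the end
  adds exactly the pairs that involve the last index.\<close>

lemma sum_list_pairs:
  fixes xs :: "real list"
  shows "(\<Sum>j<length xs. \<Sum>i<j. xs ! i * xs ! j) = ((sum_list xs)\<^sup>2 - (\<Sum>x\<leftarrow>xs. x\<^sup>2)) / 2"
proof (induction xs rule: rev_induct)
  case (snoc x xs)
  have "(\<Sum>j<length xs. \<Sum>i<j. (xs @ [x]) ! i * (xs @ [x]) ! j)
      = (\<Sum>j<length xs. \<Sum>i<j. xs ! i * xs ! j)"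
    by (intro sum.cong) (auto simp: nth_append)
  moreover have "(\<Sum>i<length xs. (xs @ [x]) ! i * (xs @ [x]) ! length xs) = sum_list xs * x"
    by (simp add: sum_list_sum_nth sum_distrib_right nth_append atLeast0LessThan)
  ultimately show ?case
    using snoc by (simp add: power2_eq_square algebra_simps)
qed simp

text \<open>Power sums depend only on the multiset of entries, so the sorting in
  \<open>eigenvalue\<close> is immaterial.\<close>

lemma sigma2_orthogonal_conjugate:
  fixes d :: "'n::finite \<Rightarrow> real"
  assumes "orthogonal_matrix Q"
  shows "sigma2 (Q ** diagonal_matrix d ** transpose Q)
    = ((\<Sum>i\<in>UNIV. d i)\<^sup>2 - (\<Sum>i\<in>UNIV. (d i)\<^sup>2)) / 2"
proof -
  let ?A = "Q ** diagonal_matrix d ** transpose Q"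
  define xs where "xs = sorted_list_of_multiset (proots (char_polynomial ?A))"
  have ms: "mset xs = image_mset d (mset_set UNIV)"
    by (simp add: xs_def proots_char_polynomial[OF assms])
  have "length xs = CARD('n)"
    using arg_cong[OF ms, of size] by simp
  then have "sigma2 ?A = (\<Sum>j<length xs. \<Sum>i<j. xs ! i * xs ! j)"
    by (simp add: sigma2_def eigenvalue_def xs_def)
  also have "\<dots> = ((sum_list xs)\<^sup>2 - (\<Sum>x\<leftarrow>xs. x\<^sup>2)) / 2"
    by (rule sum_list_pairs)
  also have "sum_list xs = (\<Sum>i\<in>UNIV. d i)"
    by (simp add: sum_unfold_sum_mset ms flip: sum_mset_sum_list)
  also have "(\<Sum>x\<leftarrow>xs. x\<^sup>2) = (\<Sum>i\<in>UNIV. (d i)\<^sup>2)"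
    by (simp add: sum_unfold_sum_mset ms multiset.map_comp o_def flip: sum_mset_sum_list)
  finally show ?thesis .
qed

text \<open>
  With \<open>t\<close> the mean and \<open>v\<close> the sum of squared deviations of the eigenvalues of \<open>A\<close>, the
  discriminant of \<open>s \<mapsto> \<sigma>\<^sub>2 (s I + A)\<close> is a positive multiple of \<open>v\<close>, so its roots are
  \<open>- t \<plusminus> r\<close> with \<open>r\<^sup>2 = v / (n (n - 1))\<close>.
\<close>

lemma sigma2_affine:
  fixes A :: "real ^ 'n ^ 'n"
  assumes n: "CARD('n) \<ge> 2" and A: "A \<in> symmetric_matrices"
  obtains r where "r \<ge> 0" and
    "\<And>x y. sigma2 (x *\<^sub>R mat 1 + y *\<^sub>R A) = real (CARD('n) choose 2) *
      ((x + y * (trace A / CARD('n) - r)) * (x + y * (trace A / CARD('n) + r)))"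
proof -
  obtain Q d where Q: "orthogonal_matrix Q" and Aeq: "A = Q ** diagonal_matrix d ** transpose Q"
    using symmetric_matrix_diagonalisation[OF A] by blast
  define n t v where "n = real CARD('n)" and "t = trace A / n" and "v = (\<Sum>i\<in>UNIV. (d i - t)\<^sup>2)"
  define r where "r = sqrt (v / (n * (n - 1)))"
  have n2: "n \<ge> 2"
    using n by (simp add: n_def)
  have choose: "real (CARD('n) choose 2) = n * (n - 1) / 2"
  proof -
    have "real (k choose 2) = real k * (real k - 1) / 2" for k
      by (induction k) (auto simp: numeral_2_eq_2 field_simps)
    then show ?thesis
      by (simp add: n_def)
  qed
  have "v \<ge> 0"
    by (simp add: v_def sum_nonneg)
  then have r: "r \<ge> 0" "n * (n - 1) * r\<^sup>2 = v"
    using n2 by (auto simp: r_def)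
  have "trace A = trace (transpose Q ** (Q ** diagonal_matrix d))"
    unfolding Aeq by (rule trace_mul_sym)
  also have "\<dots> = (\<Sum>i\<in>UNIV. d i)"
    using Q by (simp add: orthogonal_matrix_def matrix_mul_assoc)
      (simp add: trace_def diagonal_matrix_def)
  finally have sum_d: "(\<Sum>i\<in>UNIV. d i) = n * t"
    using n2 by (simp add: t_def)
  have "v = (\<Sum>i\<in>UNIV. (d i)\<^sup>2 - (2 * t) * d i + t\<^sup>2)"
    unfolding v_def by (intro sum.cong) (auto simp: power2_diff)
  also have "\<dots> = (\<Sum>i\<in>UNIV. (d i)\<^sup>2) - (2 * t) * (n * t) + n * t\<^sup>2"
    by (simp only: sum.distrib sum_subtractf sum_distrib_left[symmetric] sum_d) (simp add: n_def)
  finally have sum_d2: "(\<Sum>i\<in>UNIV. (d i)\<^sup>2) = v + n * t\<^sup>2"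
    by (simp add: power2_eq_square)
  show ?thesis
  proof (rule that[OF r(1)])
    fix x y
    have "x *\<^sub>R mat 1 + y *\<^sub>R A = Q ** diagonal_matrix (\<lambda>i. x + y * d i) ** transpose Q"
      by (simp add: Aeq orthogonal_conjugate_affine[OF Q] diagonal_matrix_affine)
    then have "sigma2 (x *\<^sub>R mat 1 + y *\<^sub>R A)
        = ((\<Sum>i\<in>UNIV. x + y * d i)\<^sup>2 - (\<Sum>i\<in>UNIV. (x + y * d i)\<^sup>2)) / 2"
      by (simp add: sigma2_orthogonal_conjugate[OF Q])
    also have "(\<Sum>i\<in>UNIV. x + y * d i) = n * (x + y * t)"
      by (simp add: sum.distrib sum_d n_def algebra_simps flip: sum_distrib_left)
    also have "(\<Sum>i\<in>UNIV. (x + y * d i)\<^sup>2) = (\<Sum>i\<in>UNIV. x\<^sup>2 + 2 * x * y * d i + y\<^sup>2 * (d i)\<^sup>2)"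
      by (intro sum.cong) (auto simp: power2_eq_square algebra_simps)
    also have "\<dots> = n * x\<^sup>2 + 2 * x * y * (n * t) + y\<^sup>2 * (v + n * t\<^sup>2)"
      by (simp add: sum.distrib sum_d sum_d2 n_def flip: sum_distrib_left)
    \<comment> \<open>With \<open>u = x + y * t\<close> the numerator is
      \<open>n * (n - 1) * u\<^sup>2 - y\<^sup>2 * v\<close>; the choice of \<open>r\<close> turns
      it into a difference of squares.\<close>
    also have "((n * (x + y * t))\<^sup>2 - (n * x\<^sup>2 + 2 * x * y * (n * t) + y\<^sup>2 * (v + n * t\<^sup>2))) / 2
        = n * (n - 1) / 2 * ((x + y * (t - r)) * (x + y * (t + r)))"
      unfolding r(2)[symmetric] by (simp add: power2_eq_square field_simps)
    finally show "sigma2 (x *\<^sub>R mat 1 + y *\<^sub>R A) = real (CARD('n) choose 2) *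
      ((x + y * (trace A / CARD('n) - r)) * (x + y * (trace A / CARD('n) + r)))"
      unfolding choose t_def n_def .
  qed
qed

section \<open>Comparison of the eigenvalues\<close>

text \<open>The sum of an affine function depends only on the mean. At the midpoint of
  \<open>a\<close> and \<open>b\<close> the chord of \<open>ln\<close> has the value
  \<open>ln (a * b) / 2\<close>.\<close>

lemma prod_mset_ge_powr_mean:
  fixes L :: "real multiset" and a b :: real
  assumes a: "0 < a" "a \<le> b" and L: "\<forall>l\<in>#L. a \<le> l \<and> l \<le> b"
    and mean: "(\<Sum>l\<in>#L. l) = size L * ((a + b) / 2)"
  shows "prod_mset L \<ge> (a * b) powr (size L / 2)"
proof -
  \<comment> \<open>The chord is \<open>u + w * x\<close>; for \<open>a = b\<close> it degenerates
    and the constant \<open>ln a\<close> serves.\<close>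
  obtain u w where uw: "\<forall>x\<in>{a..b}. u + w * x \<le> ln x" "u + w * a = ln a" "u + w * b = ln b"
  proof (cases "a = b")
    case True
    then show ?thesis
      using that[of "ln a" 0] by auto
  next
    case False
    then have ab: "a < b"
      using a by simp
    define w where "w = (ln b - ln a) / (b - a)"
    have chord: "w * (b - a) = ln b - ln a"
      using ab by (simp add: w_def)
    have "(ln a - w * a) + w * x \<le> ln x" if x: "x \<in> {a..b}" for x
    proof -
      define \<theta> where "\<theta> = (x - a) / (b - a)"
      have \<theta>: "0 \<le> \<theta>" "\<theta> \<le> 1" "x = a + \<theta> * (b - a)"
        using x ab by (auto simp: \<theta>_def)
      have "(1 - \<theta>) * ln a + \<theta> * ln b \<le> ln ((1 - \<theta>) *\<^sub>R a + \<theta> *\<^sub>R b)"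
        using \<theta> a by (intro concave_onD[OF ln_concave]) auto
      moreover have "(1 - \<theta>) *\<^sub>R a + \<theta> *\<^sub>R b = x"
        by (simp add: \<theta>(3) algebra_simps)
      moreover have "(1 - \<theta>) * ln a + \<theta> * ln b = ln a + \<theta> * (w * (b - a))"
        unfolding chord by (simp add: algebra_simps)
      moreover have "\<dots> = (ln a - w * a) + w * x"
        by (simp add: \<theta>(3) algebra_simps)
      ultimately show ?thesis
        by simp
    qed
    then show ?thesis
      using that[of "ln a - w * a" w] chord by (auto simp: algebra_simps)
  qed
  have "prod_mset K > 0 \<and> size K * u + w * (\<Sum>l\<in>#K. l) \<le> ln (prod_mset K)"
    if "\<forall>l\<in>#K. a \<le> l \<and> l \<le> b" for K
    using that
  proof (induction K)
    case (add x K)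
    then have "prod_mset K > 0" "x > 0" "u + w * x \<le> ln x"
      using a uw(1) by auto
    then show ?case
      using add by (simp add: ln_mult_pos algebra_simps)
  qed simp
  from this[OF L] have pos: "prod_mset L > 0"
    and le: "size L * u + w * (\<Sum>l\<in>#L. l) \<le> ln (prod_mset L)"
    by auto
  have "size L * u + w * (\<Sum>l\<in>#L. l) = size L / 2 * ((u + w * a) + (u + w * b))"
    unfolding mean by (simp add: field_simps)
  also have "\<dots> = size L / 2 * ln (a * b)"
    using a by (simp add: uw ln_mult)
  finally have "size L / 2 * ln (a * b) \<le> ln (prod_mset L)"
    using le by simp
  then have "exp (size L / 2 * ln (a * b)) \<le> prod_mset L"
    by (simp only: ln_ge_iff[OF pos])
  then show ?thesis
    using a by (simp add: powr_def)
qed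

text \<open>Homogeneity extracts \<open>y ^ m\<close>, which supplies one factor \<open>y\<close> to
  each of the \<open>m\<close> linear factors. A negative \<open>y\<close> is allowed and reverses
  the order of the eigenvalues.\<close>

lemma garding_eigenvalues_affine:
  fixes p :: "'a::real_normed_vector \<Rightarrow> real"
  assumes V: "subspace V" and hyp: "hyperbolic_on V m a p" and x: "x \<in> V" and y: "y \<noteq> 0"
  shows "garding_eigenvalues p a (c *\<^sub>R a + y *\<^sub>R x)
    = image_mset (\<lambda>l. c + y * l) (garding_eigenvalues p a x)"
proof (rule garding_eigenvalues_eqI)
  show "p a \<noteq> 0"
    using hyp by (simp add: hyperbolic_on_def)
  fix s
  let ?L = "garding_eigenvalues p a x"
  have a: "a \<in> V" and hom: "\<And>t x. x \<in> V \<Longrightarrow> p (t *\<^sub>R x) = t ^ m * p x"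
    using hyp by (auto simp: hyperbolic_on_def homogeneous_polynomial_on_def)
  have "s *\<^sub>R a + (c *\<^sub>R a + y *\<^sub>R x) = y *\<^sub>R (((s + c) / y) *\<^sub>R a + x)"
    using y by (simp add: algebra_simps add_divide_distrib)
  then have "p (s *\<^sub>R a + (c *\<^sub>R a + y *\<^sub>R x)) = y ^ m * p (((s + c) / y) *\<^sub>R a + x)"
    using V a x by (simp add: hom subspace_add subspace_scale)
  also have "\<dots> = p a * (y ^ size ?L * (\<Prod>l\<in>#?L. (s + c) / y + l))"
    using garding_eigenvalues_factorization(1)[OF V hyp x, of "(s + c) / y"]
      size_garding_eigenvalues[OF V hyp x] by simp
  also have "y ^ size K * (\<Prod>l\<in>#K. (s + c) / y + l) = (\<Prod>l\<in>#K. s + (c + y * l))" for K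
    using y by (induction K) (auto simp: field_simps)
  finally show "p (s *\<^sub>R a + (c *\<^sub>R a + y *\<^sub>R x))
      = p a * (\<Prod>l\<in>#image_mset (\<lambda>l. c + y * l) ?L. s + l)"
    by (simp add: multiset.map_comp o_def)
qed

theorem corollary1p4:
  fixes P :: "real ^ 'n ^ 'n \<Rightarrow> real" and m :: nat
  assumes "CARD('n) \<ge> 2"
    and "central_hyperbolic m P"
    and "garding_cone symmetric_matrices (mat 1) sigma2
           \<subseteq> garding_cone symmetric_matrices (mat 1) P"
  shows "\<forall>A \<in> garding_cone symmetric_matrices (mat 1) sigma2.
           P A powr (1 / real m) \<ge>
             P (mat 1) powr (1 / real m) *
               (sigma2 A / real (CARD('n) choose 2)) powr (1 / 2)"
proof
  let ?I = "mat 1 :: real ^ 'n ^ 'n"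
  let ?V = "symmetric_matrices :: (real ^ 'n ^ 'n) set"
  let ?N = "real (CARD('n) choose 2)"
  fix A assume AC: "A \<in> garding_cone ?V ?I sigma2"
  then have A: "A \<in> ?V"
    by (simp add: garding_cone_def)
  have V: "subspace ?V"
    by (rule subspace_symmetric_matrices)
  have I: "?I \<in> ?V"
    by (simp add: symmetric_matrices_def)
  have hyp: "hyperbolic_on ?V m ?I P"
    using assms(2) by (simp add: central_hyperbolic_def)
  then have m: "m \<ge> 1" and PI: "P ?I > 0"
    by (auto simp: hyperbolic_on_def)
  have N: "?N > 0"
    using assms(1) by simp
  define t where "t = trace A / CARD('n)"
  obtain r where r: "r \<ge> 0"
    and sig: "\<And>x y. sigma2 (x *\<^sub>R ?I + y *\<^sub>R A) = ?N * ((x + y * (t - r)) * (x + y * (t + r)))"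
    using sigma2_affine[OF assms(1) A] unfolding t_def by blast
  have sigI: "sigma2 ?I = ?N"
    using sig[of 1 0] by simp
  have ev_sigma2: "garding_eigenvalues sigma2 ?I (c *\<^sub>R ?I + y *\<^sub>R A)
      = {#c + y * (t - r), c + y * (t + r)#}" for c y
  proof (rule garding_eigenvalues_eqI)
    fix s
    show "sigma2 (s *\<^sub>R ?I + (c *\<^sub>R ?I + y *\<^sub>R A))
        = sigma2 ?I * (\<Prod>l\<in>#{#c + y * (t - r), c + y * (t + r)#}. s + l)"
      using sig[of "s + c" y] by (simp add: sigI scaleR_add_left add.assoc)
  qed (use sigI N in simp)
  \<comment> \<open>The choice \<open>c = 0\<close>, \<open>y = 1\<close> gives \<open>A\<close>
    itself, which lies in the cone.\<close>
  have pos: "t - r > 0"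
    using AC ev_sigma2[of 0 1] by (simp add: garding_cone_def)
  have sigA: "sigma2 A / ?N = (t - r) * (t + r)"
    using sig[of 0 1] N by simp
  define L where "L = garding_eigenvalues P ?I A"
  have sizeL: "size L = m"
    unfolding L_def by (rule size_garding_eigenvalues[OF V hyp A])
  have PA: "P A = P ?I * prod_mset L"
    using garding_eigenvalues_factorization(1)[OF V hyp A, of 0] by (simp add: L_def)
  have cone: "c + y * l > 0"
    \<comment> \<open>The cone inclusion on this plane: an affine function positive at both
      \<open>t - r\<close> and \<open>t + r\<close> is positive at every \<open>l\<close>.\<close>
    if "y \<noteq> 0" "c + y * (t - r) > 0" "c + y * (t + r) > 0" "l \<in># L" for c y l
  proof -
    have "c *\<^sub>R ?I + y *\<^sub>R A \<in> garding_cone ?V ?I sigma2"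
      using that V I A by (simp add: garding_cone_def ev_sigma2 subspace_add subspace_scale)
    then have "c *\<^sub>R ?I + y *\<^sub>R A \<in> garding_cone ?V ?I P"
      using assms(3) by blast
    then show ?thesis
      using that by (simp add: garding_cone_def L_def garding_eigenvalues_affine[OF V hyp A])
  qed
  have bounds: "\<forall>l\<in>#L. t - r \<le> l \<and> l \<le> t + r"
  proof
    fix l assume l: "l \<in># L"
    \<comment> \<open>The cones are given by strict inequalities, hence the shift by
      \<open>e\<close>: the test function \<open>x - (t - r) + e\<close> takes the values
      \<open>e\<close> and \<open>e + 2 * r\<close> at the two ends.\<close>
    have "t - r \<le> l"
    proof (rule field_le_epsilon)
      fix e :: real assume "e > 0"
      then show "t - r \<le> l + e"
        using cone[of 1 "e - (t - r)" l] l r by simp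
    qed
    \<comment> \<open>The reflected test function \<open>t + r + e - x\<close> takes the values
      \<open>e + 2 * r\<close> and \<open>e\<close>.\<close>
    moreover have "l \<le> t + r"
    proof (rule field_le_epsilon)
      fix e :: real assume "e > 0"
      then show "l \<le> t + r + e"
        using cone[of "-1" "t + r + e" l] l r by simp
    qed
    ultimately show "t - r \<le> l \<and> l \<le> t + r" ..
  qed
  have mean: "(\<Sum>l\<in>#L. l) = m * t"
  proof -
    obtain \<kappa> where \<kappa>: "\<And>X. X \<in> ?V \<Longrightarrow> garding_trace P ?I X = \<kappa> * trace X"
      using assms(2) by (auto simp: central_hyperbolic_def)
    \<comment> \<open>Testing centrality on \<open>I\<close>, whose eigenvalues all equal 1,
      identifies \<kappa> as \<open>m / n\<close>.\<close>
    have "P (s *\<^sub>R ?I + ?I) = P ?I * (\<Prod>l\<in>#replicate_mset m 1. s + l)" for s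
    proof -
      have "P ((s + 1) *\<^sub>R ?I) = (s + 1) ^ m * P ?I"
        using hyp I by (simp add: hyperbolic_on_def homogeneous_polynomial_on_def)
      then show ?thesis
        by (simp add: scaleR_add_left mult.commute)
    qed
    then have "garding_eigenvalues P ?I ?I = replicate_mset m 1"
      using PI by (intro garding_eigenvalues_eqI) auto
    then have "\<kappa> * CARD('n) = m"
      using \<kappa>[OF I] by (simp add: garding_trace_def trace_I)
    then show ?thesis
      using \<kappa>[OF A] by (simp add: garding_trace_def L_def t_def field_simps)
  qed
  have "((t - r) * (t + r)) powr (m / 2) \<le> prod_mset L"
    using prod_mset_ge_powr_mean[of "t - r" "t + r" L] pos r bounds mean sizeL by simp
  then have "P ?I * ((t - r) * (t + r)) powr (m / 2) \<le> P A"
    using PI by (simp add: PA)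
  then have "(P ?I * ((t - r) * (t + r)) powr (m / 2)) powr (1 / m) \<le> P A powr (1 / m)"
    using PI by (intro powr_mono2) auto
  moreover have "(P ?I * ((t - r) * (t + r)) powr (m / 2)) powr (1 / m)
      = P ?I powr (1 / m) * ((t - r) * (t + r)) powr (1 / 2)"
    using PI m by (simp add: powr_mult powr_powr)
  ultimately show "P A powr (1 / real m) \<ge>
      P ?I powr (1 / real m) * (sigma2 A / ?N) powr (1 / 2)"
    unfolding sigA by simp
qed

end
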